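(* Suppose $k\ge 0$ and $L\in[q_-(k),q_+(k)]$ are integers, and put $$u:=a^{L}\,b^{\lceil 2\sqrt{k}\,\rceil}\,a^{-L}\,b^{-\lceil 2\sqrt{k}\,\rceil}.$$ Consider a word $w$ that can be obtained from $u$ by exactly $L\,(2\lceil 2\sqrt{k}\,\rceil-L)-k$ swaps of neighboring letters; consider all cyclic shifts of $w$ and their inverses. All such words are dead end words in $H(\mathbb{Z})$ with respect to $\{a,b\}$, and any dead end word in $H(\mathbb{Z})$ with respect to $\{a,b\}$ is of that form (for some $k,L$). Moreover, any geodesic word in $H(\mathbb{Z})$ with respect to $\{a,b\}$ is a prefix of some such word.
   Context: The discrete Heisenberg group is $H(\mathbb{Z}) = \left\{ \begin{pmatrix}1 & n & k \\ 0 & 1 & m\\ 0 & 0 & 1\end{pmatrix} : n,m,k \in \mathbb{Z}\right\}$, with presentation $\langle a,b \mid [[a,b],a]=1,\ [[a,b],b]=1\rangle$, where $a,b$ correspond to $\begin{pmatrix}1 & 1 & 0 \\ 0 & 1 & 0\\ 0 & 0 & 1\end{pmatrix}$ and $\begin{pmatrix}1 & 0 & 0 \\ 0 & 1 & 1\\ 0 & 0 & 1\end{pmatrix}$ respectively, and $[u,v]=uvu^{-1}v^{-1}$. Put $S=\{a,b\}$ and $S^{-1}=\{a^{-1},b^{-1}\}$. $F(a,b)$ denotes the set of all words in the alphabet $S\cup S^{-1}$; for $w\in F(a,b)$, $|w|\ge 0$ is its length and $[w]\in H(\mathbb{Z})$ the element it represents. For $g\in H(\mathbb{Z})$, $l(g)$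 is the distance from $1$ to $g$ in the Cayley graph with respect to $S$, that is, the least length of a word in $F(a,b)$ representing $g$. A word $w$ is geodesic if $l([w])=|w|$. A geodesic word $w$ is a dead end word if $ws$ is not geodesic for all $s\in S\cup S^{-1}$. For an integer $k\ge 0$ put $$q_-(k)=\left\lceil \frac{\lceil 2\sqrt{k}\,\rceil-\sqrt{\lceil 2\sqrt{k}\,\rceil^2-4k}}{2}\right\rceil,\qquad q_+(k)=\left\lfloor \frac{\lceil 2\sqrt{k}\,\rceil+\sqrt{\lceil 2\sqrt{k}\,\rceil^2-4k}}{2}\right\rfloor.$$ A swap of neighboring letters is one of the following subword transformations of words: $ab\mapsto ba$, $ba^{-1}\mapsto a^{-1}b$, $a^{-1}b^{-1}\mapsto b^{-1}a^{-1}$, $b^{-1}a\mapsto ab^{-1}$; for example, $abbba^{-1}\mapsto babba^{-1}\mapsto baba^{-1}b$. A cyclic shift of a word $s_0s_1\cdots s_{n-1}$ (each $s_i$ a letter) is any word $s_is_{i+1}\cdots s_{i-1}$ with indices taken modulo $n$. The inverse of a word $s_1^{e_1}\cdots s_n^{e_n}$ is the word $s_n^{-e_n}\cdots s_1^{-e_1}$.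
   Formalization: As printed the claim fails (e.g. k=1). Here k≥1 replaces k≥0, u is a^L b^{⌈2√k⌉-L} a^{-L} b^{-(⌈2√k⌉-L)}, the number of swaps is L(⌈2√k⌉-L)-k, and swaps may also act on the last and first letters of a word (neighbors taken cyclically). *)

theory Defs
  imports "HOL-Analysis.Analysis" "HOL-Algebra.Group" "HOL-Library.Sublist"
begin

definition heis :: "int \<Rightarrow> int \<Rightarrow> int \<Rightarrow> int ^ 3 ^ 3" where
  "heis n m k = vector [vector [1, n, k], vector [0, 1, m], vector [0, 0, 1]]"

definition heisenberg :: "(int ^ 3 ^ 3) monoid" where
  "heisenberg = \<lparr>carrier = {heis n m k | n m k. True}, monoid.mult = (**), one = mat 1\<rparr>"

lemma heis_mult: "heis n m k ** heis n' m' k' = heis (n + n') (m + m') (k + k' + n * m')"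
  by (simp add: heis_def matrix_matrix_mult_def vec_eq_iff forall_3 sum_3 vector_3)

lemma heis_one: "mat 1 = heis 0 0 0"
  by (simp add: heis_def mat_def vec_eq_iff forall_3 vector_3)

lemma group_heisenberg: "group heisenberg"
proof (rule groupI)
  fix x assume "x \<in> carrier heisenberg"
  then obtain n m k where x: "x = heis n m k"
    by (auto simp: heisenberg_def)
  show "\<exists>y\<in>carrier heisenberg. y \<otimes>\<^bsub>heisenberg\<^esub> x = \<one>\<^bsub>heisenberg\<^esub>"
    by (rule bexI[of _ "heis (-n) (-m) (n * m - k)"])
       (auto simp: heisenberg_def x heis_mult heis_one)
next
  show "\<one>\<^bsub>heisenberg\<^esub> \<in> carrier heisenberg"
    by (auto simp: heisenberg_def heis_one)
next
  fix x y assume "x \<in> carrier heisenberg" "y \<in> carrier heisenberg"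
  then show "x \<otimes>\<^bsub>heisenberg\<^esub> y \<in> carrier heisenberg"
    by (force simp: heisenberg_def heis_mult)
qed (auto simp: heisenberg_def heis_mult heis_one matrix_mul_assoc)

datatype generator = Gen_a | Gen_b

datatype letter = Pos generator | Neg generator

type_synonym word = "letter list"

fun letter_inverse :: "letter \<Rightarrow> letter" where
  "letter_inverse (Pos x) = Neg x"
| "letter_inverse (Neg x) = Pos x"

definition inverse_word :: "word \<Rightarrow> word" where
  "inverse_word w = rev (map letter_inverse w)"

fun generator_value :: "generator \<Rightarrow> int ^ 3 ^ 3" where
  "generator_value Gen_a = heis 1 0 0"
| "generator_value Gen_b = heis 0 1 0"

fun letter_value :: "letter \<Rightarrow> int ^ 3 ^ 3" where
  "letter_value (Pos x) = generator_value x"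
| "letter_value (Neg x) = inv\<^bsub>heisenberg\<^esub> (generator_value x)"

definition word_value :: "word \<Rightarrow> int ^ 3 ^ 3" where
  "word_value w = foldr (\<lambda>x g. letter_value x \<otimes>\<^bsub>heisenberg\<^esub> g) w \<one>\<^bsub>heisenberg\<^esub>"

definition word_norm :: "int ^ 3 ^ 3 \<Rightarrow> nat" where
  "word_norm g = (LEAST n. \<exists>w. length w = n \<and> word_value w = g)"

definition geodesic_word :: "word \<Rightarrow> bool" where
  "geodesic_word w \<longleftrightarrow> word_norm (word_value w) = length w"

definition dead_end_word :: "word \<Rightarrow> bool" where
  "dead_end_word w \<longleftrightarrow> geodesic_word w \<and> (\<forall>s. \<not> geodesic_word (w @ [s]))"

definition half_perimeter :: "int \<Rightarrow> int" where
  "half_perimeter k = \<lceil>2 * sqrt (real_of_int k)\<rceil>"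

definition q_minus :: "int \<Rightarrow> int" where
  "q_minus k = \<lceil>(real_of_int (half_perimeter k)
      - sqrt (real_of_int ((half_perimeter k)\<^sup>2 - 4 * k))) / 2\<rceil>"

definition q_plus :: "int \<Rightarrow> int" where
  "q_plus k = \<lfloor>(real_of_int (half_perimeter k)
      + sqrt (real_of_int ((half_perimeter k)\<^sup>2 - 4 * k))) / 2\<rfloor>"

definition letter_power :: "generator \<Rightarrow> int \<Rightarrow> word" where
  "letter_power x e = (if e \<ge> 0 then replicate (nat e) (Pos x) else replicate (nat (- e)) (Neg x))"

text \<open>
  The boundary word of an L by (c - L) rectangle, where c = half_perimeter k.  It has length 2c,
  which is the length of the central element [a,b]^k, and it represents [a,b]^(L(c - L)).  The
  condition q_minus k \<le> L \<le> q_plus k says exactly that L(c - L) \<ge> k.  Sides L and c in place of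
  L and c - L would give a word of length 2(L + c), which is too long: for k = L = 1, two swaps
  can turn abb(a^-1)(b^-1)(b^-1) into bba(a^-1)(b^-1)(b^-1), which is not geodesic.
\<close>
definition rectangle_word :: "int \<Rightarrow> int \<Rightarrow> word" where
  "rectangle_word k L =
     letter_power Gen_a L @ letter_power Gen_b (half_perimeter k - L) @
     letter_power Gen_a (- L) @ letter_power Gen_b (- (half_perimeter k - L))"

definition swappable :: "(letter \<times> letter) set" where
  "swappable = {(Pos Gen_a, Pos Gen_b), (Pos Gen_b, Neg Gen_a),
                (Neg Gen_a, Neg Gen_b), (Neg Gen_b, Pos Gen_a)}"

text \<open>
  Indices of neighbors are taken modulo the length, as for cyclic shifts, so the last and the first
  letter are neighbors.  Without this the corner of the rectangle at the base point could never be
  cut, and for k = 3 the dead end word a(b^-1)abb(a^-1)(a^-1)(b^-1) would not be obtained.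
\<close>
definition swap_step :: "word \<Rightarrow> word \<Rightarrow> bool" where
  "swap_step w w' \<longleftrightarrow> (\<exists>i < length w.
     let j = Suc i mod length w
     in (w ! i, w ! j) \<in> swappable \<and> w' = w[i := w ! j, j := w ! i])"

definition cyclic_shifts :: "word \<Rightarrow> word set" where
  "cyclic_shifts w = {rotate i w | i. True}"

text \<open>Each swap lowers the exponent of [a,b] by one, which leads from L(c - L) to k.
  For k = 0 the family consists of the empty word, which is geodesic but not a dead end word.\<close>
definition rectangle_family :: "int \<Rightarrow> int \<Rightarrow> word set" where
  "rectangle_family k L =
     (\<Union>w \<in> {w. \<exists>n. int n = L * (half_perimeter k - L) - k \<and> (swap_step ^^ n) (rectangle_word k L) w}.
        cyclic_shifts w \<union> inverse_word ` cyclic_shifts w)"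

end

theory Submission
  imports Defs
begin

text \<open>
  A word is a lattice path whose entry k is the area between the path and the vertical axis.
  A loop with p letters a and q letters b encloses area at most pq, so the length of the central
  element [a,b]^k is twice the least c with 4k \<le> c^2.  Every cyclic shift of
  a loop represents the same central element; hence a shortest loop may be assumed to end in the
  inverse of any prescribed letter, and appending that letter shortens it: it is a dead end.
  Undoing swaps enlarges the enclosed area one unit at a time; a shortest loop on which no swap can
  be undone turns only counterclockwise and sweeps each coordinate up and down once, so it is a
  rectangle.  Finally, every geodesic word is completed to a shortest loop by
  b^t a^-(x+r) b^-(y+t) a^r, where (x,y) is its endpoint: this enlarges the bounding box without
  losing more area, until the box is close enough to a square.
\<close>

section \<open>Coordinates of words\<close>

fun a_exp :: "letter \<Rightarrow> int" where
  "a_exp (Pos Gen_a) = 1"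
| "a_exp (Neg Gen_a) = -1"
| "a_exp _ = 0"

fun b_exp :: "letter \<Rightarrow> int" where
  "b_exp (Pos Gen_b) = 1"
| "b_exp (Neg Gen_b) = -1"
| "b_exp _ = 0"

fun x_coord :: "word \<Rightarrow> int" where
  "x_coord [] = 0"
| "x_coord (l # w) = a_exp l + x_coord w"

fun y_coord :: "word \<Rightarrow> int" where
  "y_coord [] = 0"
| "y_coord (l # w) = b_exp l + y_coord w"

text \<open>The signed area to the left of the path, up to the vertical axis; for a loop, the enclosed area.\<close>

fun area :: "word \<Rightarrow> int" where
  "area [] = 0"
| "area (l # w) = a_exp l * y_coord w + area w"

abbreviation num :: "generator \<Rightarrow> word \<Rightarrow> int" where
  "num g w \<equiv> int (count_list w (Pos g))"

abbreviation num_inv :: "generator \<Rightarrow> word \<Rightarrow> int" where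
  "num_inv g w \<equiv> int (count_list w (Neg g))"

definition loop :: "word \<Rightarrow> bool" where
  "loop w \<longleftrightarrow> x_coord w = 0 \<and> y_coord w = 0"

lemma letter_cases:
  obtains "l = Pos Gen_a" | "l = Pos Gen_b" | "l = Neg Gen_a" | "l = Neg Gen_b"
  by (metis generator.exhaust letter.exhaust)

lemma a_exp_b_exp [simp]: "a_exp l * b_exp l = 0"
  by (cases l rule: letter_cases) auto

lemma x_coord_append [simp]: "x_coord (u @ v) = x_coord u + x_coord v"
  by (induction u) auto

lemma y_coord_append [simp]: "y_coord (u @ v) = y_coord u + y_coord v"
  by (induction u) auto

text \<open>Appending \<open>v\<close> translates its path by \<open>x_coord u\<close>, which adds a
  strip of that width and of height \<open>y_coord v\<close>.\<close>

lemma area_append [simp]: "area (u @ v) = area u + area v + x_coord u * y_coord v"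
  by (induction u) (auto simp: algebra_simps)

lemma x_coord_eq_num: "x_coord w = num Gen_a w - num_inv Gen_a w"
proof (induction w)
  case (Cons l w)
  then show ?case by (cases l rule: letter_cases) auto
qed simp

lemma y_coord_eq_num: "y_coord w = num Gen_b w - num_inv Gen_b w"
proof (induction w)
  case (Cons l w)
  then show ?case by (cases l rule: letter_cases) auto
qed simp

lemma length_eq_num:
  "int (length w) = num Gen_a w + num_inv Gen_a w + num Gen_b w + num_inv Gen_b w"
proof (induction w)
  case (Cons l w)
  then show ?case by (cases l rule: letter_cases) auto
qed simp

lemma length_loop: "loop w \<Longrightarrow> int (length w) = 2 * (num Gen_a w + num Gen_b w)"
  using length_eq_num[of w] by (simp add: loop_def x_coord_eq_num y_coord_eq_num)

lemma heis_eq_iff: "heis n m k = heis n' m' k' \<longleftrightarrow> n = n' \<and> m = m' \<and> k = k'"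
  by (auto simp: heis_def vec_eq_iff forall_3 vector_3)

lemma inv_heis: "inv\<^bsub>heisenberg\<^esub> (heis n m k) = heis (- n) (- m) (n * m - k)"
  by (rule group.inv_equality[OF group_heisenberg])
     (auto simp: heisenberg_def heis_mult heis_one)

lemma letter_value_eq: "letter_value l = heis (a_exp l) (b_exp l) 0"
  by (cases l rule: letter_cases) (simp_all add: inv_heis)

lemma word_value_eq: "word_value w = heis (x_coord w) (y_coord w) (area w)"
proof (induction w)
  case Nil
  show ?case by (simp add: word_value_def heisenberg_def heis_one)
next
  case (Cons l w)
  have "word_value (l # w) = letter_value l ** word_value w"
    by (simp add: word_value_def heisenberg_def)
  then show ?case
    by (simp add: Cons letter_value_eq heis_mult algebra_simps)
qed

text \<open>Equality in the group in integer coordinates; after \<open>geodesic_word_iff\<close>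
  matrices no longer occur.\<close>

definition same_element :: "word \<Rightarrow> word \<Rightarrow> bool" where
  "same_element u w \<longleftrightarrow> x_coord u = x_coord w \<and> y_coord u = y_coord w \<and> area u = area w"

lemma geodesic_word_iff: "geodesic_word w \<longleftrightarrow> (\<forall>u. same_element u w \<longrightarrow> length w \<le> length u)"
proof -
  have eq: "same_element u w \<longleftrightarrow> word_value u = word_value w" for u
    by (auto simp: same_element_def word_value_eq heis_eq_iff)
  define P where "P = (\<lambda>n. \<exists>u. length u = n \<and> word_value u = word_value w)"
  have norm: "word_norm (word_value w) = (LEAST n. P n)"
    by (simp add: word_norm_def P_def)
  have P: "P (length w)" by (auto simp: P_def)
  show ?thesis
  proof
    assume "geodesic_word w"
    then have "(LEAST n. P n) = length w" by (simp add: geodesic_word_def norm)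
    then show "\<forall>u. same_element u w \<longrightarrow> length w \<le> length u"
      by (metis (mono_tags, lifting) Least_le P_def eq)
  next
    assume "\<forall>u. same_element u w \<longrightarrow> length w \<le> length u"
    then have "(LEAST n. P n) = length w"
      by (intro Least_equality P) (auto simp: P_def eq)
    then show "geodesic_word w" by (simp add: geodesic_word_def norm)
  qed
qed

text \<open>A shorter representative of the prefix would shorten the whole word.\<close>

lemma geodesic_word_prefix:
  assumes "geodesic_word (u @ v)"
  shows "geodesic_word u"
  unfolding geodesic_word_iff
proof (intro allI impI)
  fix u' assume "same_element u' u"
  then have "same_element (u' @ v) (u @ v)" by (simp add: same_element_def)
  then show "length u \<le> length u'" using assms by (force simp: geodesic_word_iff)
qed

section \<open>Cyclic shifts and inverses of loops\<close>

lemma count_list_rotate [simp]: "count_list (rotate n w) l = count_list w l"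
proof (induction n)
  case (Suc n)
  have "count_list (rotate1 u) l = count_list u l" for u by (cases u) simp_all
  then show ?case using Suc by simp
qed simp

lemma loop_rotate [simp]: "loop (rotate n w) \<longleftrightarrow> loop w"
  by (simp add: loop_def x_coord_eq_num y_coord_eq_num)

text \<open>Moving the first letter to the end conjugates the element by that letter, and a loop
  represents a central element.\<close>

lemma area_rotate: "loop w \<Longrightarrow> area (rotate n w) = area w"
proof (induction n)
  case (Suc n)
  have "area (rotate1 u) = area u" if "loop u" for u
  proof (cases u)
    case (Cons l u')
    then have "x_coord u' = - a_exp l" "y_coord u' = - b_exp l"
      using that by (simp_all add: loop_def)
    then show ?thesis using Cons by simp
  qed simp
  then show ?case using Suc by simp
qed simp

lemma count_list_inverse_word:
  "count_list (inverse_word w) (Pos g) = count_list w (Neg g)"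
  "count_list (inverse_word w) (Neg g) = count_list w (Pos g)"
proof (induction w)
  case (Cons l w)
  { case 1 show ?case using Cons by (cases l) (simp_all add: inverse_word_def) }
  { case 2 show ?case using Cons by (cases l) (simp_all add: inverse_word_def) }
qed (simp_all add: inverse_word_def)

lemma loop_inverse_word [simp]: "loop (inverse_word w) \<longleftrightarrow> loop w"
  by (auto simp: loop_def x_coord_eq_num y_coord_eq_num count_list_inverse_word)

lemma letter_inverse_inverse [simp]: "letter_inverse (letter_inverse l) = l"
  by (cases l) auto

lemma inverse_word_inverse_word [simp]: "inverse_word (inverse_word w) = w"
  by (simp add: inverse_word_def rev_map o_def)

lemma length_inverse_word [simp]: "length (inverse_word w) = length w"
  by (simp add: inverse_word_def)

lemma exp_letter_inverse [simp]:
  "a_exp (letter_inverse l) = - a_exp l" "b_exp (letter_inverse l) = - b_exp l"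
  by (cases l rule: letter_cases; simp)+

text \<open>The product term is the correction in the matrix inverse, and the induction passes
  through words that are not loops. For a loop the area just changes sign.\<close>

lemma area_inverse_word: "area (inverse_word w) = x_coord w * y_coord w - area w"
proof (induction w)
  case Nil
  show ?case by (simp add: inverse_word_def)
next
  case (Cons l w)
  have x: "x_coord (inverse_word w) = - x_coord w"
    by (simp add: x_coord_eq_num count_list_inverse_word)
  have "inverse_word (l # w) = inverse_word w @ [letter_inverse l]"
    by (simp add: inverse_word_def)
  then show ?case using Cons x by (simp add: algebra_simps)
qed

section \<open>The isoperimetric inequality\<close>

text \<open>A letter b read at abscissa x adds x to the area and its inverse subtracts x. The
  induction removes last letters because this abscissa is that of the preceding prefix.\<close>

lemma area_le_of_bounded_prefixes:
  assumes "\<And>u. prefix u w \<Longrightarrow> m \<le> x_coord u \<and> x_coord u \<le> M"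
  shows "area w \<le> M * num Gen_b w - m * num_inv Gen_b w"
  using assms
proof (induction w rule: rev_induct)
  case (snoc l w)
  then have "area w \<le> M * num Gen_b w - m * num_inv Gen_b w" "m \<le> x_coord w" "x_coord w \<le> M"
    by auto
  then show ?case
    by (cases l rule: letter_cases) (simp_all add: algebra_simps)
qed simp

lemma ex_minimal_prefix:
  fixes f :: "word \<Rightarrow> int"
  obtains u where "prefix u w" "\<And>u'. prefix u' w \<Longrightarrow> f u \<le> f u'"
proof -
  have "\<exists>u. is_arg_min f (\<lambda>u. u \<in> set (prefixes w)) u"
    by (rule ex_is_arg_min_if_finite) auto
  then obtain u where "is_arg_min f (\<lambda>u. u \<in> set (prefixes w)) u" by blast
  then show thesis
    by (intro that[of u]) (auto simp: is_arg_min_linorder)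
qed

text \<open>Starting the loop at a point of minimal abscissa and cutting it at a point of maximal
  abscissa.\<close>

lemma loop_rotation_bound:
  assumes "loop w"
  obtains n u v where "rotate n w = u @ v" "area w \<le> x_coord u * num Gen_b w"
proof -
  obtain u1 where u1: "prefix u1 w" "\<And>u'. prefix u' w \<Longrightarrow> x_coord u1 \<le> x_coord u'"
    using ex_minimal_prefix[of w x_coord] by blast
  from u1(1) obtain w1 where w: "w = u1 @ w1" by (auto simp: prefix_def)
  define w' where "w' = w1 @ u1"
  have w': "w' = rotate (length u1) w" by (simp add: w w'_def rotate_append)
  \<comment> \<open>In the shifted loop abscissae are measured from the leftmost point. A prefix
    either stays inside \<open>w1\<close> or has gone round and entered \<open>u1\<close>
    again.\<close>
  have nonneg: "0 \<le> x_coord u" if "prefix u w'" for u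
    using that unfolding w'_def prefix_append
  proof (elim disjE exE conjE)
    assume "prefix u w1"
    then have "prefix (u1 @ u) w" by (simp add: w)
    then show ?thesis using u1(2) by fastforce
  next
    fix us assume u: "u = w1 @ us" "prefix us u1"
    then have "prefix us w" by (auto simp: w)
    then have "x_coord u1 \<le> x_coord us" using u1(2) by blast
    then show ?thesis using assms u by (auto simp: loop_def w)
  qed
  obtain u where u: "prefix u w'" "\<And>u'. prefix u' w' \<Longrightarrow> - x_coord u \<le> - x_coord u'"
    using ex_minimal_prefix[of w' "\<lambda>u. - x_coord u"] by blast
  then obtain v where v: "w' = u @ v" by (auto simp: prefix_def)
  \<comment> \<open>With lower bound 0 the inverses of b contribute nothing, and \<open>u\<close>
    ends at the rightmost point.\<close>
  have "area w' \<le> x_coord u * num Gen_b w' - 0 * num_inv Gen_b w'"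
    using nonneg u by (intro area_le_of_bounded_prefixes) force
  then have "area w \<le> x_coord u * num Gen_b w"
    using assms by (simp add: w' area_rotate)
  then show thesis using that v w' by metis
qed

text \<open>Keeping the term \<open>num_inv Gen_a u\<close> makes equality informative:
  \<open>u\<close> then contains every a and no inverse of a.\<close>

lemma x_coord_prefix_le: "rotate n w = u @ v \<Longrightarrow> x_coord u \<le> num Gen_a w - num_inv Gen_a u"
  by (metis count_list_rotate count_list_append x_coord_eq_num of_nat_add
      of_nat_0_le_iff diff_right_mono le_add_same_cancel1)

lemma area_loop_le:
  assumes "loop w"
  shows "area w \<le> num Gen_a w * num Gen_b w"
proof -
  obtain n u v where u: "rotate n w = u @ v" "area w \<le> x_coord u * num Gen_b w"
    using loop_rotation_bound[OF assms] .
  have "x_coord u \<le> num Gen_a w" using x_coord_prefix_le[OF u(1)] by simp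
  then have "x_coord u * num Gen_b w \<le> num Gen_a w * num Gen_b w"
    by (intro mult_right_mono) auto
  with u show ?thesis by simp
qed

lemma four_mult_le_square: "4 * (p * q) \<le> (p + q)\<^sup>2" for p q :: int
proof -
  have "0 \<le> (p - q)\<^sup>2" by simp
  then show ?thesis by (simp add: power2_eq_square algebra_simps)
qed

text \<open>This and the next two lemmas trade the ceiling and the root for integer inequalities:
  for positive k, \<open>half_perimeter k\<close> is the c with (c - 1)^2 < 4k \<le> c^2.\<close>

lemma half_perimeter_le:
  assumes "4 * k \<le> c\<^sup>2" "0 \<le> c"
  shows "half_perimeter k \<le> c"
proof -
  have "4 * real_of_int k \<le> (real_of_int c)\<^sup>2" using assms(1) by (metis of_int_le_iff of_int_mult of_int_numeral of_int_power)
  then have "sqrt (4 * real_of_int k) \<le> real_of_int c"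
    using assms(2) by (simp add: real_le_lsqrt)
  then show ?thesis by (simp add: half_perimeter_def ceiling_le_iff real_sqrt_mult)
qed

lemma half_perimeter_eq:
  assumes "(c - 1)\<^sup>2 < 4 * k" "4 * k \<le> c\<^sup>2" "0 \<le> c"
  shows "half_perimeter k = c"
proof -
  have "real_of_int ((c - 1)\<^sup>2) < real_of_int (4 * k)" using assms(1) by (rule of_int_less_iff[THEN iffD2])
  then have "real_of_int (c - 1) < sqrt (4 * real_of_int k)"
    by (intro real_less_rsqrt) simp
  then have "c - 1 < half_perimeter k"
    by (simp add: half_perimeter_def less_ceiling_iff real_sqrt_mult)
  with half_perimeter_le[OF assms(2,3)] show ?thesis by simp
qed

lemma half_perimeter_bounds:
  assumes "k \<ge> 1"
  shows "half_perimeter k \<ge> 1" "4 * k \<le> (half_perimeter k)\<^sup>2"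
    "(half_perimeter k - 1)\<^sup>2 < 4 * k"
proof -
  let ?h = "half_perimeter k" and ?s = "2 * sqrt (real_of_int k)"
  have s: "?s > 0" "?s\<^sup>2 = real_of_int (4 * k)" using assms by (simp_all add: power_mult_distrib)
  have h: "real_of_int ?h - 1 < ?s" "?s \<le> real_of_int ?h"
    unfolding half_perimeter_def by linarith+
  show pos: "?h \<ge> 1" using s(1) h(2) by linarith
  have "?s\<^sup>2 \<le> (real_of_int ?h)\<^sup>2" using h(2) s(1) by (intro power_mono) auto
  then have "real_of_int (4 * k) \<le> real_of_int (?h\<^sup>2)" using s(2) by simp
  then show "4 * k \<le> ?h\<^sup>2" by (rule of_int_le_iff[THEN iffD1])
  have "(real_of_int ?h - 1)\<^sup>2 < ?s\<^sup>2" using h(1) pos by (intro power_strict_mono) auto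
  then have "real_of_int ((?h - 1)\<^sup>2) < real_of_int (4 * k)" using s(2) by simp
  then show "(?h - 1)\<^sup>2 < 4 * k" by (rule of_int_less_iff[THEN iffD1])
qed

text \<open>The enclosed area is at most pq, hence at most (p + q)^2 / 4, while the length is 2(p +
  q). Negative area is handled by inverting the loop.\<close>

lemma length_loop_ge:
  assumes "loop w"
  shows "2 * half_perimeter \<bar>area w\<bar> \<le> int (length w)"
proof -
  have pos: "2 * half_perimeter (area u) \<le> int (length u)" if "loop u" "area u \<ge> 0" for u
  proof -
    have "4 * area u \<le> (num Gen_a u + num Gen_b u)\<^sup>2"
      using area_loop_le[OF that(1)] four_mult_le_square[of "num Gen_a u" "num Gen_b u"] by linarith
    then show ?thesis using half_perimeter_le[of "area u"] length_loop[OF that(1)] by force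
  qed
  show ?thesis
  proof (cases "area w \<ge> 0")
    case False
    then show ?thesis using pos[of "inverse_word w"] assms
      by (simp add: area_inverse_word) (simp add: loop_def)
  qed (use pos assms in auto)
qed

lemma geodesic_loop:
  assumes "loop w" "int (length w) = 2 * half_perimeter \<bar>area w\<bar>"
  shows "geodesic_word w"
  unfolding geodesic_word_iff
proof (intro allI impI)
  fix u assume "same_element u w"
  with assms show "length w \<le> length u"
    using length_loop_ge[of u] by (simp add: same_element_def loop_def)
qed

section \<open>Short words\<close>

lemma coords_replicate [simp]:
  "x_coord (replicate n l) = int n * a_exp l" "y_coord (replicate n l) = int n * b_exp l"
  by (induction n) (auto simp: algebra_simps)

lemma area_replicate [simp]: "area (replicate n l) = 0"
  by (induction n) (auto simp: algebra_simps)

text \<open>Induction on the height: either the last b stands at the right end and accounts for area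
  x, or a single b at abscissa k accounts for all of it.\<close>

lemma ex_monotone_word:
  assumes "k \<le> x * y"
  obtains w where "x_coord w = int x" "y_coord w = int y" "area w = int k" "length w = x + y"
  using assms
proof (induction y arbitrary: k thesis)
  case 0
  show ?case by (rule 0(1)[of "replicate x (Pos Gen_a)"]) (use 0 in auto)
next
  case (Suc y)
  show ?case
  proof (cases "k \<ge> x")
    case True
    have "k - x \<le> x * y" using Suc.prems(2) by simp
    then obtain w where w: "x_coord w = int x" "y_coord w = int y" "area w = int (k - x)"
        "length w = x + y"
      using Suc.IH by blast
    show ?thesis by (rule Suc.prems(1)[of "w @ [Pos Gen_b]"]) (use w True in auto)
  next
    case False
    show ?thesis
      by (rule Suc.prems(1)[of "replicate y (Pos Gen_b) @ replicate k (Pos Gen_a) @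
            Pos Gen_b # replicate (x - k) (Pos Gen_a)"])
         (use False in auto)
  qed
qed

lemma geodesic_length_le:
  assumes "geodesic_word w" "0 \<le> area w" "area w \<le> i * h"
    "0 \<le> i" "0 \<le> h" "x_coord w \<le> i" "y_coord w \<le> h"
  shows "int (length w) \<le> 2 * (i + h) - x_coord w - y_coord w"
proof -
  have "int (nat (area w)) \<le> int (nat i * nat h)" using assms by simp
  then have "nat (area w) \<le> nat i * nat h" by linarith
  then obtain m where m: "x_coord m = int (nat i)" "y_coord m = int (nat h)"
      "area m = int (nat (area w))" "length m = nat i + nat h"
    by (rule ex_monotone_word)
  \<comment> \<open>Vertical steps at abscissa 0 and horizontal steps at the end sweep no area, so
    they correct the endpoint of \<open>m\<close> and keep its area.\<close>
  define u where "u = replicate (nat (h - y_coord w)) (Neg Gen_b) @ m @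
      replicate (nat (i - x_coord w)) (Neg Gen_a)"
  have "same_element u w"
    using assms m by (auto simp: u_def same_element_def)
  then have "length w \<le> length u" using assms(1) by (simp add: geodesic_word_iff)
  moreover have "int (length u) = 2 * (i + h) - x_coord w - y_coord w"
    using assms m by (simp add: u_def)
  ultimately show ?thesis by linarith
qed


section \<open>Swaps\<close>

text \<open>The quarter turn to the left. The allowed swaps are those that replace a left turn by a
  right turn, so four cases become one.\<close>

fun turn :: "letter \<Rightarrow> letter" where
  "turn (Pos Gen_a) = Pos Gen_b"
| "turn (Pos Gen_b) = Neg Gen_a"
| "turn (Neg Gen_a) = Neg Gen_b"
| "turn (Neg Gen_b) = Pos Gen_a"

lemma swappable_iff: "(l, l') \<in> swappable \<longleftrightarrow> l' = turn l"
  by (cases l rule: letter_cases; cases l' rule: letter_cases) (auto simp: swappable_def)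

lemma turn_turn [simp]: "turn (turn l) = letter_inverse l"
  by (cases l rule: letter_cases) auto

text \<open>One m serves all words of the given length, so a shift can be undone simultaneously on
  both words of a swap.\<close>

lemma ex_rotate_inverse: "\<exists>m. \<forall>w. length w = n \<longrightarrow> rotate m (rotate i w) = w"
proof (intro exI allI impI)
  fix w :: "'a list" assume "length w = n"
  have "n - i mod n + i = n * (i div n + 1)" if "n > 0"
    using mod_less_divisor[OF that, of i] mult_div_mod_eq[of n i] by (simp only: distrib_left)
  then have "(n - i mod n + i) mod length w = 0" if "n > 0"
    using that \<open>length w = n\<close> by simp
  then show "rotate (n - i mod n) (rotate i w) = w"
    using \<open>length w = n\<close> by (cases "n = 0") (simp_all add: rotate_rotate rotate_id)
qed

lemma rotate_list_update2:
  assumes "i < length w" "length w \<ge> 2"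
  defines "j \<equiv> Suc i mod length w"
  shows "rotate i (w[i := y, j := x]) = y # x # drop 2 (rotate i w)"
proof (rule nth_equalityI)
  show "length (rotate i (w[i := y, j := x])) = length (y # x # drop 2 (rotate i w))"
    using assms by simp
next
  fix k assume "k < length (rotate i (w[i := y, j := x]))"
  then have k: "k < length w" by simp
  have j: "j = (if Suc i = length w then 0 else Suc i)"
    using assms(1) by (simp add: j_def)
  then have len: "j < length w" "j \<noteq> i" using assms(1,2) by auto
  have nth: "rotate i v ! k = v ! ((i + k) mod length v)" if "length v = length w" for v :: "'a list"
    using that k by (simp add: nth_rotate)
  consider "k = 0" | "k = 1" | m where "k = Suc (Suc m)"
    by (metis One_nat_def not0_implies_Suc)
  then show "rotate i (w[i := y, j := x]) ! k = (y # x # drop 2 (rotate i w)) ! k"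
  proof cases
    case 3
    have "(i + k) mod length w \<noteq> i" "(i + k) mod length w \<noteq> j"
      using 3 k assms(1) j by (cases "i + k < length w"; simp add: le_mod_geq; linarith)+
    then show ?thesis using 3 k nth by (simp add: nth)
  qed (use nth assms len in \<open>auto simp: j_def\<close>)
qed

text \<open>Shifting the swapped pair to the front confines the index arithmetic modulo the length
  to this proof.\<close>

lemma swap_step_iff:
  "swap_step w w' \<longleftrightarrow> (\<exists>i l u. rotate i w = l # turn l # u \<and> rotate i w' = turn l # l # u)"
proof
  assume "swap_step w w'"
  then obtain i j where i: "i < length w" "j = Suc i mod length w"
      "w ! j = turn (w ! i)" "w' = w[i := w ! j, j := w ! i]"
    by (auto simp: swap_step_def swappable_iff Let_def)
  \<comment> \<open>In a one-letter word the cyclic neighbor is the letter itself, and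
    \<open>turn\<close> has no fixed point.\<close>
  have "length w \<noteq> 1"
  proof
    assume "length w = 1"
    with i have "w ! i = turn (w ! i)" by simp
    then show False by (cases "w ! i" rule: letter_cases) auto
  qed
  with i have len: "length w \<ge> 2" by linarith
  have "rotate i w = w ! i # turn (w ! i) # drop 2 (rotate i w)"
    using rotate_list_update2[OF i(1) len, of "w ! i" "w ! j"] i by simp
  moreover have "rotate i w' = turn (w ! i) # w ! i # drop 2 (rotate i w)"
    using rotate_list_update2[OF i(1) len, of "w ! j" "w ! i"] i by simp
  ultimately show "\<exists>i l u. rotate i w = l # turn l # u \<and> rotate i w' = turn l # l # u"
    by blast
next
  assume "\<exists>i l u. rotate i w = l # turn l # u \<and> rotate i w' = turn l # l # u"
  then obtain i0 l u where i0: "rotate i0 w = l # turn l # u" "rotate i0 w' = turn l # l # u"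
    by blast
  define i where "i = i0 mod length w"
  have lens: "length w = length u + 2" "length w' = length w"
    using arg_cong[OF i0(1), of length] arg_cong[OF i0(2), of length] by simp_all
  have i: "i < length w" "rotate i w = l # turn l # u" "rotate i w' = turn l # l # u"
    using i0 lens rotate_conv_mod[of i0 w] rotate_conv_mod[of i0 w'] by (auto simp: i_def)
  let ?j = "Suc i mod length w"
  have "rotate i w ! 0 = w ! i" "rotate i w ! 1 = w ! ?j"
    using i(1) lens by (simp_all add: nth_rotate)
  then have w: "w ! i = l" "w ! ?j = turn l" using i(2) by simp_all
  have "rotate i (w[i := turn l, ?j := l]) = rotate i w'"
    using rotate_list_update2[of i w] i lens by simp
  then have "w' = w[i := turn l, ?j := l]"
    using ex_rotate_inverse[of "length w" i] lens by (metis length_list_update)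
  then show "swap_step w w'"
    using i(1) w by (auto simp: swap_step_def swappable_iff Let_def)
qed

lemma swap_step_length: "swap_step w w' \<Longrightarrow> length w' = length w"
  by (auto simp: swap_step_def Let_def)

lemma swap_step_rotate:
  assumes "swap_step w w'"
  shows "swap_step (rotate m w) (rotate m w')"
proof -
  obtain i l u where "rotate i w = l # turn l # u" "rotate i w' = turn l # l # u"
    using assms by (auto simp: swap_step_iff)
  moreover obtain m' where "rotate m' (rotate m w) = w" "rotate m' (rotate m w') = w'"
    using ex_rotate_inverse[of "length w" m] swap_step_length[OF assms] by blast
  ultimately show ?thesis unfolding swap_step_iff
    by (metis rotate_rotate)
qed

lemma swap_steps_rotate:
  "(swap_step ^^ n) w w' \<Longrightarrow> (swap_step ^^ n) (rotate m w) (rotate m w')"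
proof (induction n arbitrary: w')
  case (Suc n)
  then show ?case by (auto intro: swap_step_rotate)
qed simp

lemma swap_step_count_list:
  assumes "swap_step w w'"
  shows "count_list w' l = count_list w l"
proof -
  obtain i l' u where "rotate i w = l' # turn l' # u" "rotate i w' = turn l' # l' # u"
    using assms by (auto simp: swap_step_iff)
  then have "count_list (rotate i w') l = count_list (rotate i w) l" by simp
  then show ?thesis by simp
qed

text \<open>Cutting a left-turning corner pushes the path across one unit cell on its left, which is
  lost from the area.\<close>

lemma swap_step_area:
  assumes "swap_step w w'" "loop w"
  shows "loop w'" "area w' = area w - 1"
proof -
  show loop: "loop w'"
    using assms swap_step_count_list[OF assms(1)]
    by (simp add: loop_def x_coord_eq_num y_coord_eq_num)
  obtain i l u where "rotate i w = l # turn l # u" "rotate i w' = turn l # l # u"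
    using assms by (auto simp: swap_step_iff)
  then have "area (rotate i w') = area (rotate i w) - 1"
    by (cases l rule: letter_cases) auto
  then show "area w' = area w - 1" using assms loop by (simp add: area_rotate)
qed

lemma swap_steps_area:
  "(swap_step ^^ n) w w' \<Longrightarrow> loop w \<Longrightarrow>
     loop w' \<and> area w' = area w - int n \<and> (\<forall>l. count_list w' l = count_list w l)"
proof (induction n arbitrary: w')
  case (Suc n)
  then show ?case using swap_step_area swap_step_count_list by fastforce
qed simp

definition rectangle :: "nat \<Rightarrow> nat \<Rightarrow> word" where
  "rectangle p q = replicate p (Pos Gen_a) @ replicate q (Pos Gen_b) @
     replicate p (Neg Gen_a) @ replicate q (Neg Gen_b)"

lemma loop_rectangle [simp]: "loop (rectangle p q)"
  by (simp add: loop_def rectangle_def)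

lemma area_rectangle [simp]: "area (rectangle p q) = int p * int q"
  by (simp add: rectangle_def)

lemma count_list_replicate: "count_list (replicate n l) l' = (if l = l' then n else 0)"
  by (induction n) auto

lemma count_list_rectangle:
  "count_list (rectangle p q) (Pos Gen_a) = p" "count_list (rectangle p q) (Neg Gen_a) = p"
  "count_list (rectangle p q) (Pos Gen_b) = q" "count_list (rectangle p q) (Neg Gen_b) = q"
  by (simp_all add: rectangle_def count_list_replicate)

lemma rectangle_word_eq:
  assumes "0 \<le> L" "L \<le> half_perimeter k"
  shows "rectangle_word k L = rectangle (nat L) (nat (half_perimeter k - L))"
  using assms by (auto simp: rectangle_word_def rectangle_def letter_power_def)

section \<open>Tight loops\<close>

text \<open>For a loop of length 2c the condition reads (c - 1)^2 < 4 |area|: no loop of length 2(c - 1)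
  can enclose this area.\<close>

definition tight :: "word \<Rightarrow> bool" where
  "tight w \<longleftrightarrow> loop w \<and> (int (length w) - 2)\<^sup>2 < 16 * \<bar>area w\<bar>"

lemma tight_iff:
  "tight w \<longleftrightarrow> loop w \<and> (num Gen_a w + num Gen_b w - 1)\<^sup>2 < 4 * \<bar>area w\<bar>"
proof (cases "loop w")
  case True
  then have "(int (length w) - 2)\<^sup>2 = 4 * (num Gen_a w + num Gen_b w - 1)\<^sup>2"
    by (simp add: length_loop power2_eq_square algebra_simps)
  then show ?thesis using True by (auto simp: tight_def)
qed (simp add: tight_def)

lemma tight_inverse_word [simp]: "tight (inverse_word w) \<longleftrightarrow> tight w"
  by (auto simp: tight_def area_inverse_word loop_def[of w])

text \<open>Rigidity: smaller p or q would give p + q \<le> c - 1 for a loop of length 2c, and 4pq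
  \<le> (p + q)^2 would contradict tightness.\<close>

lemma tight_area_bound:
  assumes "tight w" "area w > 0" "p \<le> num Gen_a w" "q \<le> num Gen_b w" "area w \<le> p * q"
    and "0 \<le> q"
  shows "p = num Gen_a w \<and> q = num Gen_b w"
proof (rule ccontr)
  assume "\<not> ?thesis"
  then have less: "p + q \<le> num Gen_a w + num Gen_b w - 1" using assms(3,4) by linarith
  have "p * q > 0" using assms(2,5) by linarith
  \<comment> \<open>Positivity of the product gives the sign of p; the sum must be nonnegative
    before the inequality is squared.\<close>
  then have "0 \<le> p + q" using assms(6) by (auto simp: zero_less_mult_iff)
  then have "(p + q)\<^sup>2 \<le> (num Gen_a w + num Gen_b w - 1)\<^sup>2"
    using less by (intro power_mono) auto
  then show False using assms four_mult_le_square[of p q] by (simp add: tight_iff)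
qed

text \<open>Deleting a cancelling pair would leave a loop with the same area and half the length
  less by one.\<close>

lemma tight_no_cancellation:
  assumes "tight w" "area w > 0"
  shows "rotate i w \<noteq> l # letter_inverse l # u"
proof
  assume eq: "rotate i w = l # letter_inverse l # u"
  have "loop w" using assms by (simp add: tight_def)
  then have "loop u" "area u = area w"
    using area_rotate[of w i] loop_rotate[of i w] eq by (auto simp: loop_def)
  then have le: "area w \<le> num Gen_a u * num Gen_b u"
    using area_loop_le[of u] by simp
  have "count_list w l' = count_list (l # letter_inverse l # u) l'" for l'
    using eq by (metis count_list_rotate)
  then have "num Gen_a w + num Gen_b w = num Gen_a u + num Gen_b u + 1"
     "num Gen_a u \<le> num Gen_a w" "num Gen_b u \<le> num Gen_b w"
    by (cases l rule: letter_cases; simp)+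
  then show False using tight_area_bound[OF assms _ _ le] by simp
qed

lemma successivelyI:
  "(\<And>xs l l' ys. w = xs @ l # l' # ys \<Longrightarrow> P l l') \<Longrightarrow> successively P w"
proof (induction w)
  case (Cons l w)
  have "successively P w" by (rule Cons.IH) (metis Cons.prems append_Cons)
  moreover have "P l (hd w)" if "w \<noteq> []"
    using Cons.prems[of "[]" l "hd w" "tl w"] that by simp
  ultimately show ?case by (auto simp: successively_Cons)
qed simp

lemma successively_turn_replicate:
  "successively (\<lambda>l l'. l' = l \<or> l' = turn l) (l # w) \<Longrightarrow> turn l \<notin> set w \<Longrightarrow>
     w = replicate (length w) l"
  by (induction w) (auto simp: successively_Cons split: if_splits)

text \<open>A path that only goes straight or turns left reaches the opposite direction at its
  second turn; avoiding that direction allows one turn at most.\<close>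

lemma successively_turn_replicate2:
  "successively (\<lambda>l l'. l' = l \<or> l' = turn l) (l # w) \<Longrightarrow> letter_inverse l \<notin> set w \<Longrightarrow>
     \<exists>i j. w = replicate i l @ replicate j (turn l)"
proof (induction w)
  case (Cons l' w)
  show ?case
  proof (cases "l' = l")
    case True
    then obtain i j where "w = replicate i l @ replicate j (turn l)"
      using Cons by (auto simp: successively_Cons)
    then have "l' # w = replicate (Suc i) l @ replicate j (turn l)" using True by simp
    then show ?thesis by blast
  next
    case False
    then have l': "l' = turn l" using Cons.prems by simp
    then have "w = replicate (length w) (turn l)"
      using Cons.prems successively_turn_replicate[of "turn l" w] by simp
    then have "l' # w = replicate 0 l @ replicate (Suc (length w)) (turn l)" using l' by simp
    then show ?thesis by blast
  qed
qed simp

text \<open>Rigidity puts every a on one arc between the leftmost and rightmost points and every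
  inverse of a on the other. Each arc turns at most once, so there are four straight sides.\<close>

lemma tight_stuck_imp_rectangle:
  assumes w: "tight w" "area w > 0"
    and stuck: "\<nexists>i l u. rotate i w = turn l # l # u"
  shows "\<exists>m. w = rotate m (rectangle (count_list w (Pos Gen_a)) (count_list w (Pos Gen_b)))"
proof -
  let ?p = "count_list w (Pos Gen_a)" and ?q = "count_list w (Pos Gen_b)"
  have loop: "loop w" using w by (simp add: tight_def)
  then have inv: "count_list w (Neg Gen_a) = ?p" "count_list w (Neg Gen_b) = ?q"
    by (simp_all add: loop_def x_coord_eq_num y_coord_eq_num)
  have "int ?p * int ?q > 0" using area_loop_le[OF loop] w(2) by simp
  then have pos: "?p > 0" "?q > 0" by (auto simp: zero_less_mult_iff)
  \<comment> \<open>Of the four possible successors of a letter, the inverse is excluded by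
    tightness and the right turn by \<open>stuck\<close>.\<close>
  have succ: "successively (\<lambda>l l'. l' = l \<or> l' = turn l) (rotate i w)" for i
  proof (rule successivelyI)
    fix xs l l' ys assume "rotate i w = xs @ l # l' # ys"
    then have "rotate (length xs) (rotate i w) = l # l' # ys @ xs" by (simp add: rotate_append)
    then have "rotate (length xs + i) w = l # l' # ys @ xs" by (simp add: rotate_rotate)
    then have "l' \<noteq> letter_inverse l" "l \<noteq> turn l'"
      using tight_no_cancellation[OF w] stuck by blast+
    then show "l' = l \<or> l' = turn l"
      by (cases l rule: letter_cases; cases l' rule: letter_cases) auto
  qed
  obtain n u v where u: "rotate n w = u @ v" "area w \<le> x_coord u * num Gen_b w"
    using loop_rotation_bound[OF loop] .
  have "x_coord u \<le> num Gen_a w" using x_coord_prefix_le[OF u(1)] by simp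
  then have "x_coord u = num Gen_a w"
    using tight_area_bound[OF w _ _ u(2)] by simp
  then have "num_inv Gen_a u = 0" "num Gen_a u = num Gen_a w"
    using x_coord_prefix_le[OF u(1)] x_coord_eq_num[of u] by simp_all
  moreover have count: "count_list w l = count_list u l + count_list v l" for l
    using u(1) by (metis count_list_rotate count_list_append)
  ultimately have none: "Neg Gen_a \<notin> set u" "Pos Gen_a \<notin> set v"
    and "Pos Gen_a \<in> set u" "Neg Gen_a \<in> set v"
    using pos inv count[of "Pos Gen_a"] count[of "Neg Gen_a"] count_list_0_iff[of u "Pos Gen_a"]
      count_list_0_iff[of u "Neg Gen_a"] count_list_0_iff[of v "Pos Gen_a"]
      count_list_0_iff[of v "Neg Gen_a"] by auto
  \<comment> \<open>The arcs are recut to begin at the first a and at the first inverse of a: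
    \<open>u1\<close> passes to the second arc, \<open>v1\<close> to the first.\<close>
  then obtain u1 u2 where u12: "u = u1 @ Pos Gen_a # u2" "Pos Gen_a \<notin> set u1"
    by (meson split_list_first)
  have "Neg Gen_a \<in> set (v @ u1)" using \<open>Neg Gen_a \<in> set v\<close> by simp
  then obtain v1 v2 where v12: "v @ u1 = v1 @ Neg Gen_a # v2" "Neg Gen_a \<notin> set v1"
    by (meson split_list_first)
  have "Pos Gen_a \<notin> set (v @ u1)" using none u12 by simp
  then have "Pos Gen_a \<notin> set v2" using v12 by simp
  define U where "U = u2 @ v1"
  have rot: "rotate (length u1 + n) w = (Pos Gen_a # U) @ Neg Gen_a # v2"
  proof -
    have "rotate (length u1 + n) w = rotate (length u1) (u1 @ Pos Gen_a # u2 @ v)"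
      by (simp add: u(1) u12 flip: rotate_rotate)
    also have "\<dots> = Pos Gen_a # u2 @ (v @ u1)" by (simp add: rotate_append)
    finally show ?thesis by (simp add: v12 U_def)
  qed
  have "successively (\<lambda>l l'. l' = l \<or> l' = turn l) (Pos Gen_a # U)"
       "successively (\<lambda>l l'. l' = l \<or> l' = turn l) (Neg Gen_a # v2)"
    using succ[of "length u1 + n"] unfolding rot successively_append_iff by blast+
  moreover have "Neg Gen_a \<notin> set U" using none u12 v12 by (simp add: U_def)
  ultimately obtain i j i' j' where U:
    "U = replicate i (Pos Gen_a) @ replicate j (Pos Gen_b)"
    "v2 = replicate i' (Neg Gen_a) @ replicate j' (Neg Gen_b)"
    using successively_turn_replicate2[of "Pos Gen_a" U] \<open>Pos Gen_a \<notin> set v2\<close>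
      successively_turn_replicate2[of "Neg Gen_a" v2] by auto
  then have rot': "rotate (length u1 + n) w = rectangle (Suc i) j"
    if "Suc i' = Suc i" "j' = j" using that by (simp add: rot rectangle_def)
  \<comment> \<open>In a loop each letter is as frequent as its inverse, so opposite sides are
    equally long.\<close>
  have "count_list w l = count_list ((Pos Gen_a # U) @ Neg Gen_a # v2) l" for l
    using rot by (metis count_list_rotate)
  from this[of "Pos Gen_a"] this[of "Pos Gen_b"] this[of "Neg Gen_a"] this[of "Neg Gen_b"]
  have "?p = Suc i" "?q = j" "?p = Suc i'" "?q = j'"
    using inv U by (simp_all add: count_list_replicate)
  then have "rotate (length u1 + n) w = rectangle ?p ?q" using rot' by simp
  then show ?thesis using ex_rotate_inverse[of "length w" "length u1 + n"] by metis
qed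

text \<open>Undoing swaps enlarges the area until the loop is a rectangle.\<close>

lemma tight_from_rectangle:
  assumes "tight w" "area w > 0" "int n = num Gen_a w * num Gen_b w - area w"
  shows "\<exists>m. (swap_step ^^ n)
    (rotate m (rectangle (count_list w (Pos Gen_a)) (count_list w (Pos Gen_b)))) w"
  using assms
proof (induction n arbitrary: w rule: less_induct)
  case (less n w)
  show ?case
  proof (cases "\<exists>i l u. rotate i w = turn l # l # u")
    case True
    then obtain i l u where i: "rotate i w = turn l # l # u" by blast
    define w0 where "w0 = l # turn l # u"
    have "length w0 = length w" using arg_cong[OF i, of length] by (simp add: w0_def)
    then obtain m where m: "rotate m (rotate i w) = w" "rotate i (rotate m w0) = w0"
      using ex_rotate_inverse[of "length w" i] ex_rotate_inverse[of "length w" i]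
      by (metis add.commute rotate_rotate)
    define w' where "w' = rotate m w0"
    have step: "swap_step w' w" using m i by (auto simp: swap_step_iff w'_def w0_def)
    have count: "count_list w l' = count_list w' l'" for l' by (rule swap_step_count_list[OF step])
    have "loop w'" using less.prems count by (simp add: tight_def loop_def x_coord_eq_num y_coord_eq_num)
    then have area: "area w = area w' - 1" using swap_step_area[OF step] by simp
    \<comment> \<open>Undoing a swap keeps the letters and raises the area, so tightness
      persists.\<close>
    have "tight w'" using less.prems \<open>loop w'\<close> area count by (simp add: tight_iff)
    \<comment> \<open>The isoperimetric inequality for \<open>w'\<close> leaves room for the undone
      swap, so n is positive and the induction descends.\<close>
    have "area w' \<le> num Gen_a w' * num Gen_b w'" using area_loop_le[OF \<open>loop w'\<close>] .
    then have "n > 0" using less.prems area count by simp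
    then obtain n' where n: "n = Suc n'" using gr0_conv_Suc by blast
    obtain m' where "(swap_step ^^ n')
        (rotate m' (rectangle (count_list w' (Pos Gen_a)) (count_list w' (Pos Gen_b)))) w'"
      using less.IH[of n' w'] less.prems \<open>tight w'\<close> area count n by auto
    then show ?thesis using step n count by auto
  next
    case False
    obtain m where m: "w = rotate m (rectangle (count_list w (Pos Gen_a)) (count_list w (Pos Gen_b)))"
      using tight_stuck_imp_rectangle[OF less.prems(1,2) False] by blast
    then have "area w = num Gen_a w * num Gen_b w"
      by (metis area_rotate area_rectangle loop_rectangle)
    then have "n = 0" using less.prems by simp
    then show ?thesis using m by (auto intro: sym)
  qed
qed

section \<open>The rectangle family, tight loops and dead ends\<close>

lemma mem_q_range_iff:
  assumes "k \<ge> 1"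
  shows "L \<in> {q_minus k..q_plus k} \<longleftrightarrow> k \<le> L * (half_perimeter k - L)"
proof -
  let ?c = "half_perimeter k"
  let ?s = "sqrt (real_of_int (?c\<^sup>2 - 4 * k))"
  \<comment> \<open>The bounds are the roots of L^2 - cL + k, rounded inwards, where c is
    \<open>half_perimeter k\<close>.\<close>
  have "L \<in> {q_minus k..q_plus k} \<longleftrightarrow> \<bar>real_of_int (?c - 2 * L)\<bar> \<le> ?s"
    by (auto simp: q_minus_def q_plus_def ceiling_le_iff le_floor_iff abs_le_iff field_simps)
  also have "\<dots> \<longleftrightarrow> (real_of_int (?c - 2 * L))\<^sup>2 \<le> real_of_int (?c\<^sup>2 - 4 * k)"
    using half_perimeter_bounds(2)[OF assms]
    by (metis abs_le_square_iff abs_of_nonneg of_int_0_le_iff diff_ge_0_iff_ge real_sqrt_ge_zero real_sqrt_pow2)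
  also have "\<dots> \<longleftrightarrow> (?c - 2 * L)\<^sup>2 \<le> ?c\<^sup>2 - 4 * k"
    by (metis of_int_le_iff of_int_power)
  also have "\<dots> \<longleftrightarrow> k \<le> L * (?c - L)"
    by (auto simp: power2_eq_square algebra_simps)
  finally show ?thesis .
qed

lemma tight_imp_rectangle_family:
  assumes "tight w"
  shows "\<exists>k L. k \<ge> 1 \<and> L \<in> {q_minus k..q_plus k} \<and> w \<in> rectangle_family k L"
proof -
  have pos: "\<exists>k L i v n. k \<ge> 1 \<and> L \<in> {q_minus k..q_plus k} \<and> w = rotate i v \<and>
      int n = L * (half_perimeter k - L) - k \<and> (swap_step ^^ n) (rectangle_word k L) v"
    if w: "tight w" "area w > 0" for w
  proof -
    let ?p = "num Gen_a w" and ?q = "num Gen_b w"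
    have loop: "loop w" using w by (simp add: tight_def)
    have le: "area w \<le> ?p * ?q" by (rule area_loop_le[OF loop])
    \<comment> \<open>Tightness gives the strict lower bound and the isoperimetric inequality the
      upper one.\<close>
    have hp: "half_perimeter (area w) = ?p + ?q"
      using w le four_mult_le_square[of ?p ?q] by (intro half_perimeter_eq) (auto simp: tight_iff)
    define n where "n = nat (?p * ?q - area w)"
    have n: "int n = ?p * ?q - area w" using le by (simp add: n_def)
    obtain m where m: "(swap_step ^^ n) (rotate m (rectangle (nat ?p) (nat ?q))) w"
      using tight_from_rectangle[OF w n] by auto
    obtain m' where m': "\<And>v :: word. length v = length (rectangle (nat ?p) (nat ?q)) \<Longrightarrow>
        rotate m' (rotate m v) = v"
      using ex_rotate_inverse[of "length (rectangle (nat ?p) (nat ?q))" m] by metis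
    \<comment> \<open>The chain of swaps starts at a shifted rectangle. Shifting the whole chain
      back makes it start at the rectangle and end at \<open>v\<close>, a cyclic shift of
      \<open>w\<close>.\<close>
    define v where "v = rotate m' w"
    have "(swap_step ^^ n) (rectangle (nat ?p) (nat ?q)) v"
      using swap_steps_rotate[OF m, of m'] by (simp only: v_def m'[OF refl])
    moreover obtain i where "w = rotate i v"
      using ex_rotate_inverse[of "length w" m'] unfolding v_def by metis
    moreover have "rectangle_word (area w) ?p = rectangle (nat ?p) (nat ?q)"
      by (subst rectangle_word_eq) (auto simp: hp)
    moreover have "?p \<in> {q_minus (area w)..q_plus (area w)}"
      using w le hp by (subst mem_q_range_iff) auto
    ultimately show ?thesis using w n hp by (intro exI[of _ "area w"] exI[of _ ?p]) auto
  qed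
  have "area w \<noteq> 0" using assms by (auto simp: tight_def)
  then consider "area w > 0" | "area (inverse_word w) > 0"
    using assms by (fastforce simp: area_inverse_word tight_def loop_def)
  then show ?thesis
  proof cases
    case 1
    from pos[OF assms this] show ?thesis
      unfolding rectangle_family_def cyclic_shifts_def by blast
  next
    case 2
    have "tight (inverse_word w)" using assms by simp
    from pos[OF this 2] obtain k L i v n where
      *: "k \<ge> 1" "L \<in> {q_minus k..q_plus k}" "inverse_word w = rotate i v"
      "int n = L * (half_perimeter k - L) - k" "(swap_step ^^ n) (rectangle_word k L) v" by blast
    have "w = inverse_word (rotate i v)" using *(3) by (metis inverse_word_inverse_word)
    with * show ?thesis
      unfolding rectangle_family_def cyclic_shifts_def by blast
  qed
qed

lemma dead_end_loop:
  assumes "loop w" "int (length w) = 2 * half_perimeter \<bar>area w\<bar>" "set w = UNIV"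
  shows "dead_end_word w"
  unfolding dead_end_word_def
proof (intro conjI allI)
  show "geodesic_word w" using geodesic_loop assms by blast
  fix s
  have "letter_inverse s \<in> set w" using assms(3) by simp
  then obtain u v where w: "w = u @ letter_inverse s # v" by (meson split_list)
  have "rotate (length u) w = letter_inverse s # v @ u" by (simp add: w rotate_append)
  then have "rotate (Suc (length u)) w = (v @ u) @ [letter_inverse s]" by simp
  then have "area w = area ((v @ u) @ [letter_inverse s])" using assms(1) by (metis area_rotate)
  \<comment> \<open>The loop rotated to end in the inverse of \<open>s\<close> still represents the
    element of \<open>w\<close>; appending \<open>s\<close> cancels that last letter.\<close>
  then have "same_element (v @ u) (w @ [s])"
    using assms(1) by (auto simp: same_element_def loop_def w algebra_simps)
  moreover have "length (v @ u) < length (w @ [s])" by (simp add: w)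
  ultimately show "\<not> geodesic_word (w @ [s])" unfolding geodesic_word_iff by (meson not_less)
qed

lemma rectangle_family_dead_end:
  assumes "k \<ge> 1" "L \<in> {q_minus k..q_plus k}" "v \<in> rectangle_family k L"
  shows "dead_end_word v"
proof -
  let ?c = "half_perimeter k"
  \<comment> \<open>Both sides of the rectangle are therefore positive, so all four letters occur in
    it, and swaps preserve letter counts.\<close>
  have "L * (?c - L) > 0" using assms mem_q_range_iff by fastforce
  then have L: "0 < L" "0 < ?c - L"
    using half_perimeter_bounds(1)[OF assms(1)] by (auto simp: zero_less_mult_iff)
  obtain w n i where n: "int n = L * (?c - L) - k" "(swap_step ^^ n) (rectangle_word k L) w"
    and v: "v = rotate i w \<or> v = inverse_word (rotate i w)"
    using assms(3) by (auto simp: rectangle_family_def cyclic_shifts_def)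
  have eq: "rectangle_word k L = rectangle (nat L) (nat (?c - L))"
    using L by (simp add: rectangle_word_eq)
  have w: "loop w" "area w = k" "\<And>l. count_list w l = count_list (rectangle (nat L) (nat (?c - L))) l"
    using swap_steps_area[OF n(2)] n(1) L by (auto simp: eq)
  have "count_list w l \<noteq> 0" for l
    using L by (cases l rule: letter_cases) (simp_all add: w(3) count_list_rectangle)
  then have "set w = UNIV" by (auto simp: count_list_0_iff)
  moreover have "set (inverse_word (rotate i w)) = letter_inverse ` set w"
    by (simp add: inverse_word_def)
  moreover have "surj letter_inverse" by (metis letter_inverse_inverse surjI)
  ultimately have "set v = UNIV" using v by auto
  moreover have "int (length w) = 2 * ?c"
    using L by (simp add: length_loop w(1) w(3) count_list_rectangle)
  moreover have "x_coord (rotate i w) = 0" using w(1) by (metis loop_def loop_rotate)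
  then have "\<bar>area v\<bar> = k" "loop v" "length v = length w"
    using v w assms(1) by (auto simp: area_rotate area_inverse_word)
  ultimately show ?thesis by (intro dead_end_loop) auto
qed

section \<open>Extending geodesics to tight loops\<close>

definition extends_to_tight :: "word \<Rightarrow> bool" where
  "extends_to_tight w \<longleftrightarrow> (\<exists>v. tight (w @ v))"

text \<open>Here i and h are the sides of a bounding box of least half perimeter s that has room for the
  area k.  If x > s/2, the box is too elongated, and t raises it to an x by x square.\<close>

lemma ex_box_aux:
  fixes x y k :: int
  assumes "0 \<le> y" "y \<le> x" "x * y < k"
  shows "\<exists>i h t. x \<le> i \<and> y \<le> h \<and> 0 \<le> t \<and> k \<le> i * h \<and> (i + h + t - 1)\<^sup>2 < 4 * (k + x * t)"
proof -
  define P where "P = (\<lambda>n. \<exists>i h. x \<le> i \<and> y \<le> h \<and> k \<le> i * h \<and> i + h = int n)"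
  have "0 \<le> x * y" using assms by simp
  then have k: "k \<ge> 1" using assms by linarith
  \<comment> \<open>A crude box with enough room, so that a least half perimeter exists.\<close>
  have "k * 1 \<le> (x + k) * (y + 1)" using assms k by (intro mult_mono) auto
  then have "P (nat (x + k + (y + 1)))"
    unfolding P_def using assms k by (intro exI[of _ "x + k"] exI[of _ "y + 1"]) auto
  then obtain n where n: "P n" "\<And>m. m < n \<Longrightarrow> \<not> P m"
    by (metis exists_least_iff)
  define s where "s = int n"
  from n(1) obtain i h where ih: "x \<le> i" "y \<le> h" "k \<le> i * h" "i + h = s"
    by (auto simp: P_def s_def)
  have small: "i' * h' < k" if "x \<le> i'" "y \<le> h'" "i' + h' = s - 1" for i' h'
  proof -
    have "\<not> P (nat (s - 1))" using n(2)[of "nat (s - 1)"] that assms by (simp add: s_def)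
    moreover have "int (nat (s - 1)) = s - 1" using that assms by simp
    ultimately show ?thesis using that unfolding P_def by (metis not_le)
  qed
  have "x + y \<noteq> s"
  proof
    assume "x + y = s"
    then have "i = x" "h = y" using ih by auto
    then show False using ih assms by simp
  qed
  then have xy: "x + y \<le> s - 1" using ih by linarith
  show ?thesis
  proof (cases "2 * x \<le> s")
    case True
    \<comment> \<open>The most nearly square box of half perimeter s - 1 still contains the x by y
      box. By minimality its area, at least ((s - 1)^2 - 1) / 4, is below k.\<close>
    define i' where "i' = s div 2"
    have i': "s = 2 * i' \<or> s = 2 * i' + 1" unfolding i'_def by presburger
    have "i' * (s - 1 - i') < k" using True i' xy assms by (intro small) auto
    moreover have "(s - 1)\<^sup>2 \<le> 4 * (i' * (s - 1 - i')) + 1"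
      using i' by (elim disjE) (simp_all add: power2_eq_square algebra_simps)
    ultimately have "(s - 1)\<^sup>2 < 4 * k" by linarith
    then show ?thesis using ih by (intro exI[of _ i] exI[of _ h] exI[of _ 0]) simp
  next
    case False
    \<comment> \<open>Minimality applied to width x. With t = 2x - s the enlarged half perimeter is
      2x, that of a square of side x.\<close>
    have "x * (s - 1 - x) < k" using xy by (intro small) auto
    then have "x * (s - 1 - x) + 1 \<le> k" by simp
    then have "(2 * x - 1)\<^sup>2 < 4 * (k + x * (2 * x - s))"
      by (simp add: power2_eq_square algebra_simps)
    moreover have "i + h + (2 * x - s) - 1 = 2 * x - 1" using ih by simp
    ultimately show ?thesis
      using ih False by (intro exI[of _ i] exI[of _ h] exI[of _ "2 * x - s"]) simp
  qed
qed

text \<open>Here i and h bound the length of the given geodesic, r and t enlarge its box, and the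
  last inequality makes the completed loop tight.\<close>

lemma ex_box:
  fixes x y k :: int
  assumes "0 \<le> x" "0 \<le> y" "0 \<le> k"
  shows "\<exists>i h r t. x \<le> i \<and> y \<le> h \<and> 0 \<le> r \<and> 0 \<le> t \<and> k \<le> i * h \<and>
    (i + h + r + t - 1)\<^sup>2 < 4 * (k + x * t + r * y + r * t)"
proof (cases "k \<le> x * y")
  case True
  \<comment> \<open>Completing to an X by X square loses the fixed area xy - k, which tightness
    tolerates once X exceeds it.\<close>
  define X where "X = x + y + (x * y - k) + 1"
  have "0 \<le> X - x" "0 \<le> X - y" "x * y - k < X" using assms True by (auto simp: X_def)
  moreover have "(x + y + (X - x) + (X - y) - 1)\<^sup>2 = 4 * X\<^sup>2 - 4 * X + 1"
    by (simp add: power2_eq_square algebra_simps)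
  moreover have "k + x * (X - y) + (X - x) * y + (X - x) * (X - y) = X\<^sup>2 - (x * y - k)"
    by (simp add: power2_eq_square algebra_simps)
  ultimately show ?thesis using True
    by (intro exI[of _ x] exI[of _ y] exI[of _ "X - x"] exI[of _ "X - y"]) simp
next
  case False
  show ?thesis
  proof (cases "y \<le> x")
    case True
    have "x * y < k" using False by simp
    from ex_box_aux[OF assms(2) True this] obtain i h t where
      "x \<le> i" "y \<le> h" "0 \<le> t" "k \<le> i * h" "(i + h + t - 1)\<^sup>2 < 4 * (k + x * t)" by blast
    then show ?thesis by (intro exI[of _ i] exI[of _ h] exI[of _ 0] exI[of _ t]) simp
  next
    case yx: False
    have "x \<le> y" "y * x < k" using False yx by (simp_all add: mult.commute)
    \<comment> \<open>The axes are exchanged, so the enlargement t of the auxiliary lemma becomes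
      r.\<close>
    from ex_box_aux[OF assms(1) this] obtain i h t where
      "y \<le> i" "x \<le> h" "0 \<le> t" "k \<le> i * h" "(i + h + t - 1)\<^sup>2 < 4 * (k + y * t)"
      by blast
    then show ?thesis
      by (intro exI[of _ h] exI[of _ i] exI[of _ t] exI[of _ 0]) (simp add: algebra_simps)
  qed
qed

lemma extends_to_tight_first_octant:
  assumes w: "geodesic_word w" "0 \<le> x_coord w" "0 \<le> y_coord w" "0 \<le> area w"
  shows "extends_to_tight w"
proof -
  let ?x = "x_coord w" and ?y = "y_coord w"
  from ex_box[OF w(2-4)] obtain i h r t where
    ih: "?x \<le> i" "?y \<le> h" "0 \<le> r" "0 \<le> t" "area w \<le> i * h" and
    K: "(i + h + r + t - 1)\<^sup>2 < 4 * (area w + ?x * t + r * ?y + r * t)" by blast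
  define v where "v = replicate (nat t) (Pos Gen_b) @ replicate (nat (?x + r)) (Neg Gen_a) @
      replicate (nat (?y + t)) (Neg Gen_b) @ replicate (nat r) (Pos Gen_a)"
  have loop: "loop (w @ v)" using w ih by (simp add: v_def loop_def)
  have area: "area (w @ v) = area w + ?x * t + r * ?y + r * t"
    using w ih by (simp add: v_def algebra_simps)
  have "int (length w) \<le> 2 * (i + h) - ?x - ?y"
    using w ih by (intro geodesic_length_le) auto
  then have le: "int (length (w @ v)) \<le> 2 * (i + h + r + t)"
    using w ih by (simp add: v_def)
  have K': "(i + h + r + t - 1)\<^sup>2 < 4 * area (w @ v)" unfolding area by (rule K)
  have "0 < 4 * area (w @ v)" by (rule le_less_trans[OF zero_le_power2 K'])
  then have pos: "area (w @ v) \<ge> 1" by simp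
  \<comment> \<open>The length minus 2 must be nonnegative before the upper bound is
    squared.\<close>
  have "int (length (w @ v)) \<ge> 2"
    using length_loop_ge[OF loop] half_perimeter_bounds(1)[OF pos] pos by simp
  then have "(int (length (w @ v)) - 2)\<^sup>2 \<le> (2 * (i + h + r + t - 1))\<^sup>2"
    using le by (intro power_mono) auto
  also have "\<dots> = 4 * (i + h + r + t - 1)\<^sup>2" by (simp only: power_mult_distrib) simp
  also have "\<dots> < 16 * area (w @ v)" using K' by linarith
  finally show ?thesis using loop pos by (auto simp: extends_to_tight_def tight_def)
qed

section \<open>Symmetries and reduction to nonnegative coordinates and area\<close>

lemma symmetry_transfer:
  assumes inv: "\<And>l. f (f l) = l"
    and same: "\<And>u w. same_element u w \<Longrightarrow> same_element (map f u) (map f w)"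
    and tight: "\<And>w. tight w \<Longrightarrow> tight (map f w)"
  shows "geodesic_word w \<Longrightarrow> geodesic_word (map f w)"
    and "extends_to_tight (map f w) \<Longrightarrow> extends_to_tight w"
proof -
  have [simp]: "map f (map f w) = w" for w by (simp add: inv o_def)
  show "geodesic_word w \<Longrightarrow> geodesic_word (map f w)"
    unfolding geodesic_word_iff using same by (metis \<open>\<And>w. map f (map f w) = w\<close> length_map)
  show "extends_to_tight (map f w) \<Longrightarrow> extends_to_tight w"
    unfolding extends_to_tight_def using tight by (metis \<open>\<And>w. map f (map f w) = w\<close> map_append)
qed

text \<open>With \<open>exchange\<close>, the letterwise form of two group automorphisms: a to its
  inverse, and a interchanged with b. Acting letter by letter, they respect prefixes.\<close>

fun reflect :: "letter \<Rightarrow> letter" where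
  "reflect (Pos Gen_a) = Neg Gen_a"
| "reflect (Neg Gen_a) = Pos Gen_a"
| "reflect l = l"

fun swap_gen :: "generator \<Rightarrow> generator" where
  "swap_gen Gen_a = Gen_b"
| "swap_gen Gen_b = Gen_a"

fun exchange :: "letter \<Rightarrow> letter" where
  "exchange (Pos g) = Pos (swap_gen g)"
| "exchange (Neg g) = Neg (swap_gen g)"

lemma exp_reflect: "a_exp (reflect l) = - a_exp l" "b_exp (reflect l) = b_exp l"
  by (cases l rule: letter_cases; simp)+

lemma exp_exchange: "a_exp (exchange l) = b_exp l" "b_exp (exchange l) = a_exp l"
  by (cases l rule: letter_cases; simp)+

lemma coords_map_reflect:
  "x_coord (map reflect w) = - x_coord w" "y_coord (map reflect w) = y_coord w"
  "area (map reflect w) = - area w"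
proof -
  show "x_coord (map reflect w) = - x_coord w" by (induction w) (auto simp: exp_reflect)
  have y: "y_coord (map reflect w) = y_coord w" for w by (induction w) (auto simp: exp_reflect)
  show "y_coord (map reflect w) = y_coord w" by (rule y)
  show "area (map reflect w) = - area w" by (induction w) (auto simp: exp_reflect y)
qed

lemma coords_map_exchange:
  "x_coord (map exchange w) = y_coord w" "y_coord (map exchange w) = x_coord w"
  "area (map exchange w) = x_coord w * y_coord w - area w"
proof -
  show "x_coord (map exchange w) = y_coord w" by (induction w) (auto simp: exp_exchange)
  have y: "y_coord (map exchange w) = x_coord w" for w by (induction w) (auto simp: exp_exchange)
  show "y_coord (map exchange w) = x_coord w" by (rule y)
  show "area (map exchange w) = x_coord w * y_coord w - area w"
    by (induction w) (simp_all add: exp_exchange y algebra_simps)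
qed

lemma reflect_transfer:
  "geodesic_word w \<Longrightarrow> geodesic_word (map reflect w)"
  "extends_to_tight (map reflect w) \<Longrightarrow> extends_to_tight w"
proof -
  have inv: "reflect (reflect l) = l" for l by (cases l rule: letter_cases) auto
  have same: "same_element (map reflect u) (map reflect w)" if "same_element u w" for u w
    using that by (simp add: same_element_def coords_map_reflect)
  have tight: "tight (map reflect w)" if "tight w" for w
    using that by (simp add: tight_def loop_def coords_map_reflect)
  show "geodesic_word w \<Longrightarrow> geodesic_word (map reflect w)"
    "extends_to_tight (map reflect w) \<Longrightarrow> extends_to_tight w"
    using symmetry_transfer[of reflect, OF inv same tight] by blast+
qed

lemma exchange_transfer:
  "geodesic_word w \<Longrightarrow> geodesic_word (map exchange w)"
  "extends_to_tight (map exchange w) \<Longrightarrow> extends_to_tight w"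
proof -
  have inv: "exchange (exchange l) = l" for l by (cases l rule: letter_cases) auto
  have same: "same_element (map exchange u) (map exchange w)" if "same_element u w" for u w
    using that by (simp add: same_element_def coords_map_exchange)
  have tight: "tight (map exchange w)" if "tight w" for w
    using that by (simp add: tight_def loop_def coords_map_exchange)
  show "geodesic_word w \<Longrightarrow> geodesic_word (map exchange w)"
    "extends_to_tight (map exchange w) \<Longrightarrow> extends_to_tight w"
    using symmetry_transfer[of exchange, OF inv same tight] by blast+
qed

lemma geodesic_extends_to_tight:
  assumes "geodesic_word w"
  shows "extends_to_tight w"
proof -
  have 1: "extends_to_tight w" if "geodesic_word w" "0 \<le> x_coord w" "0 \<le> y_coord w" for w
  proof (cases "0 \<le> area w")
    case False
    moreover have "0 \<le> x_coord w * y_coord w" using that by simp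
    \<comment> \<open>Exchanging the axes turns the area into its complement in the x by y
      rectangle.\<close>
    ultimately have "0 \<le> area (map exchange w)" by (simp add: coords_map_exchange)
    then have "extends_to_tight (map exchange w)"
      using that by (intro extends_to_tight_first_octant exchange_transfer(1))
        (simp_all add: coords_map_exchange)
    then show ?thesis by (rule exchange_transfer(2))
  qed (use that extends_to_tight_first_octant in blast)
  have 2: "extends_to_tight w" if "geodesic_word w" "0 \<le> y_coord w" for w
  proof (cases "0 \<le> x_coord w")
    case False
    have "extends_to_tight (map reflect w)"
      by (rule 1) (use that False in \<open>auto simp: coords_map_reflect reflect_transfer(1)\<close>)
    then show ?thesis by (rule reflect_transfer(2))
  qed (use that 1 in blast)
  \<comment> \<open>Exchanging the axes moves the sign condition from y to x, leaving only a
    reflection for negative x.\<close>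
  have 3: "extends_to_tight w" if "geodesic_word w" "0 \<le> x_coord w" for w
    using 2[of "map exchange w"] that
    by (auto simp: coords_map_exchange intro: exchange_transfer)
  show ?thesis
  proof (cases "0 \<le> x_coord w")
    case False
    have "extends_to_tight (map reflect w)"
      by (rule 3) (use assms False in \<open>auto simp: coords_map_reflect reflect_transfer(1)\<close>)
    then show ?thesis by (rule reflect_transfer(2))
  qed (use assms 3 in blast)
qed

theorem theorem1p7:
  shows "(\<forall>(k::int) (L::int) v. k \<ge> 1 \<and> L \<in> {q_minus k..q_plus k} \<and> v \<in> rectangle_family k L
            \<longrightarrow> dead_end_word v)
       \<and> (\<forall>v. dead_end_word v \<longrightarrow>
            (\<exists>(k::int) (L::int). k \<ge> 1 \<and> L \<in> {q_minus k..q_plus k} \<and> v \<in> rectangle_family k L))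
       \<and> (\<forall>w. geodesic_word w \<longrightarrow>
            (\<exists>(k::int) (L::int) v. k \<ge> 1 \<and> L \<in> {q_minus k..q_plus k} \<and> v \<in> rectangle_family k L
               \<and> prefix w v))"
proof (intro conjI)
  show "\<forall>(k::int) (L::int) v. k \<ge> 1 \<and> L \<in> {q_minus k..q_plus k} \<and> v \<in> rectangle_family k L
            \<longrightarrow> dead_end_word v"
    using rectangle_family_dead_end by blast
  show extension: "\<forall>w. geodesic_word w \<longrightarrow>
            (\<exists>(k::int) (L::int) v. k \<ge> 1 \<and> L \<in> {q_minus k..q_plus k} \<and> v \<in> rectangle_family k L
               \<and> prefix w v)"
  proof (intro allI impI)
    fix w assume "geodesic_word w"
    then obtain v where "tight (w @ v)"
      using geodesic_extends_to_tight by (auto simp: extends_to_tight_def)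
    from tight_imp_rectangle_family[OF this]
    show "\<exists>(k::int) (L::int) v. k \<ge> 1 \<and> L \<in> {q_minus k..q_plus k} \<and> v \<in> rectangle_family k L
               \<and> prefix w v"
      by (metis prefixI)
  qed
  show "\<forall>v. dead_end_word v \<longrightarrow>
            (\<exists>(k::int) (L::int). k \<ge> 1 \<and> L \<in> {q_minus k..q_plus k} \<and> v \<in> rectangle_family k L)"
  proof (intro allI impI)
    fix v assume v: "dead_end_word v"
    then obtain k L u where *: "k \<ge> 1" "L \<in> {q_minus k..q_plus k}" "u \<in> rectangle_family k L"
        "prefix v u"
      using extension unfolding dead_end_word_def by blast
    from \<open>prefix v u\<close> obtain z where u: "u = v @ z" by (auto simp: prefix_def)
    \<comment> \<open>Otherwise v followed by one letter would be a prefix of a geodesic, hence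
      geodesic, although v is a dead end.\<close>
    have "z = []"
    proof (cases z)
      case (Cons s z')
      have "geodesic_word ((v @ [s]) @ z')"
        using rectangle_family_dead_end[OF *(1-3)] u Cons by (simp add: dead_end_word_def)
      then show ?thesis using v geodesic_word_prefix unfolding dead_end_word_def by blast
    qed simp
    then show "\<exists>(k::int) (L::int). k \<ge> 1 \<and> L \<in> {q_minus k..q_plus k} \<and> v \<in> rectangle_family k L"
      using * u by auto
  qed
qed

end
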